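(* As formal power series in $q$, $$\sum_{n\ge0}q^n\sum_{\lambda\vdash n}\prod_{u\in\lambda}\frac{(c_{sp}^{\lambda}(u))^2}{(h^{\lambda}(u))^2}=\prod_{j\ge1}\frac{1}{1-q^{4j-2}}=\sum_{n\ge0}q^n\sum_{\lambda\vdash n}\prod_{u\in\lambda}\frac{(c_{O}^{\lambda}(u))^2}{(h^{\lambda}(u))^2}.$$
   Context: For a partition $\lambda$ with conjugate $\lambda'$ (cells $(i,j)$ = row $i$, column $j$ of the Young diagram; $\lambda_i=0$ beyond the length): hook length $h^\lambda(i,j)=\lambda_i+\lambda'_j-i-j+1$; symplectic content $c^\lambda_{sp}(i,j)=\lambda_i+\lambda_j-i-j+2$ if $i>j$ and $c^\lambda_{sp}(i,j)=i+j-\lambda'_i-\lambda'_j$ if $i\le j$; orthogonal content $c^\lambda_O(i,j)=\lambda_i+\lambda_j-i-j$ if $i\ge j$ and $c^\lambda_O(i,j)=i+j-\lambda'_i-\lambda'_j-2$ if $i<j$. The empty partition contributes the empty product $1$ for $n=0$. *)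

theory Defs
  imports "HOL-Analysis.Analysis"
begin

text \<open>
  Partitions are weakly decreasing lists of positive parts. All row and column indices
  below start at 1, as in the usual matrix convention for Young diagrams.
\<close>

definition partitions_of :: "nat \<Rightarrow> nat list set" where
  "partitions_of n = {xs. sorted_wrt (\<ge>) xs \<and> 0 \<notin> set xs \<and> sum_list xs = n}"

definition part :: "nat list \<Rightarrow> nat \<Rightarrow> nat" where
  "part xs i = (if 1 \<le> i \<and> i \<le> length xs then xs ! (i - 1) else 0)"

definition diagram :: "nat list \<Rightarrow> (nat \<times> nat) set" where
  "diagram xs = {(i, j). 1 \<le> i \<and> i \<le> length xs \<and> 1 \<le> j \<and> j \<le> part xs i}"

text \<open>The \<open>j\<close>-th part of the conjugate partition, i.e. the length of column \<open>j\<close>.\<close>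

definition conj_part :: "nat list \<Rightarrow> nat \<Rightarrow> nat" where
  "conj_part xs j = card {i. (i, j) \<in> diagram xs}"

fun hook_length :: "nat list \<Rightarrow> nat \<times> nat \<Rightarrow> int" where
  "hook_length xs (i, j) = int (part xs i) + int (conj_part xs j) - int i - int j + 1"

fun sp_content :: "nat list \<Rightarrow> nat \<times> nat \<Rightarrow> int" where
  "sp_content xs (i, j) =
    (if i > j then int (part xs i) + int (part xs j) - int i - int j + 2
     else int i + int j - int (conj_part xs i) - int (conj_part xs j))"

fun orth_content :: "nat list \<Rightarrow> nat \<times> nat \<Rightarrow> int" where
  "orth_content xs (i, j) =
    (if i \<ge> j then int (part xs i) + int (part xs j) - int i - int j
     else int i + int j - int (conj_part xs i) - int (conj_part xs j) - 2)"

text \<open>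
  The two finiteness facts guard against degenerate readings of the finite sums over
  \<open>partitions_of\<close> and products over \<open>diagram\<close>.
\<close>

lemma finite_partitions_of: "finite (partitions_of n)"
proof (rule finite_subset)
  show "partitions_of n \<subseteq> {xs. set xs \<subseteq> {..n} \<and> length xs \<le> n}"
  proof
    fix xs assume "xs \<in> partitions_of n"
    then have z: "0 \<notin> set xs" and s: "sum_list xs = n"
      by (auto simp: partitions_of_def)
    have "length xs \<le> sum_list xs"
      using z by (induction xs) auto
    moreover have "x \<le> n" if "x \<in> set xs" for x
      using member_le_sum_list[OF that] s by simp
    ultimately show "xs \<in> {xs. set xs \<subseteq> {..n} \<and> length xs \<le> n}"
      using s by auto
  qed
  show "finite {xs. set xs \<subseteq> {..n} \<and> length xs \<le> n}"
    by (rule finite_lists_length_le) simp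
qed

lemma finite_diagram: "finite (diagram xs)"
proof (rule finite_subset)
  show "diagram xs \<subseteq> (SIGMA i:{..length xs}. {..part xs i})"
    by (auto simp: diagram_def)
qed simp

end

theory Submission
  imports Defs
begin

text \<open>
  Each product over a diagram is \<open>0\<close> or \<open>1\<close>. If \<open>\<lambda>'\<^sub>i = \<lambda>\<^sub>i + 1\<close> for all diagonal indices \<open>i\<close>
  (in the orthogonal case \<open>\<lambda>\<^sub>i = \<lambda>'\<^sub>i + 1\<close>), then every content equals the hook length of
  its cell up to sign; otherwise some cell has content zero. Peeling off principal hooks, whose
  sizes are even, identifies the surviving partitions of \<open>n\<close> with the strict partitions of
  \<open>n / 2\<close>. Their generating function is \<open>\<Prod>\<^sub>j (1 + q\<^bsup>2j\<^esup>)\<close>, which is the claimed product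
  by Euler's theorem on odd and distinct parts.
\<close>

section \<open>Rows, columns and hooks of a diagram\<close>

lemma part_antimono:
  assumes "sorted_wrt (\<ge>) xs" "1 \<le> i" "i \<le> j"
  shows "part xs j \<le> part xs i"
proof (cases "i = j")
  case False
  with assms show ?thesis
    by (auto simp: part_def sorted_wrt_iff_nth_less)
qed simp

lemma part_pos_imp_le_length: "1 \<le> j \<Longrightarrow> j \<le> part xs i \<Longrightarrow> 1 \<le> i \<and> i \<le> length xs"
  by (auto simp: part_def split: if_splits)

text \<open>By monotonicity column \<open>j\<close> fills an initial segment of the rows, so its
  cardinality is its last row. The equivalence also covers indices outside the diagram, and
  \<open>conj_part\<close> is never unfolded again.\<close>

lemma le_part_iff_le_conj_part:
  assumes "sorted_wrt (\<ge>) xs" "1 \<le> i" "1 \<le> j"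
  shows "j \<le> part xs i \<longleftrightarrow> i \<le> conj_part xs j"
proof -
  define D where "D = {i. (i, j) \<in> diagram xs}"
  have D: "D = {i. 1 \<le> i \<and> j \<le> part xs i}"
    using assms(3) part_pos_imp_le_length[of j xs] by (auto simp: D_def diagram_def)
  have fin: "finite D"
    by (rule finite_subset[of _ "{..length xs}"]) (auto simp: D_def diagram_def)
  show ?thesis
  proof
    assume "j \<le> part xs i"
    then have "{1..i} \<subseteq> D"
      using part_antimono[OF assms(1)] by (fastforce simp: D)
    from card_mono[OF fin this] show "i \<le> conj_part xs j"
      by (simp add: conj_part_def D_def)
  next
    assume le: "i \<le> conj_part xs j"
    show "j \<le> part xs i"
    proof (rule ccontr)
      assume neg: "\<not> j \<le> part xs i"
      have "D \<subseteq> {1..<i}"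
      proof
        fix k assume "k \<in> D"
        then show "k \<in> {1..<i}"
          using neg part_antimono[OF assms(1,2), of k] by (force simp: D)
      qed
      from card_mono[OF _ this] have "card D \<le> i - 1" by simp
      with le assms(2) show False by (simp add: conj_part_def D_def)
    qed
  qed
qed

lemma diagram_iff: "(i, j) \<in> diagram xs \<longleftrightarrow> 1 \<le> i \<and> 1 \<le> j \<and> j \<le> part xs i"
  using part_pos_imp_le_length[of j xs i] by (auto simp: diagram_def)

lemma diagram_iff_conj:
  assumes "sorted_wrt (\<ge>) xs"
  shows "(i, j) \<in> diagram xs \<longleftrightarrow> 1 \<le> i \<and> 1 \<le> j \<and> i \<le> conj_part xs j"
  using le_part_iff_le_conj_part[OF assms] by (auto simp: diagram_iff)

lemma hook_length_pos:
  assumes "sorted_wrt (\<ge>) xs" "u \<in> diagram xs"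
  shows "hook_length xs u > 0"
proof -
  obtain i j where u: "u = (i, j)" by (cases u)
  show ?thesis
    using assms(2) diagram_iff[of i j xs] diagram_iff_conj[OF assms(1), of i j] by (simp add: u)
qed

section \<open>Cells of content zero\<close>

text \<open>
  At the last diagonal index \<open>j\<close> with \<open>q j \<noteq> p j + 1\<close>, the cell
  \<open>(p j + 2, j)\<close> or the cell \<open>(j, q j)\<close> lies on the rim and has content zero.
\<close>

lemma ex_zero_content_cell:
  fixes p q :: "nat \<Rightarrow> nat"
  assumes conj: "\<And>i j. 1 \<le> i \<Longrightarrow> 1 \<le> j \<Longrightarrow> j \<le> p i \<longleftrightarrow> i \<le> q j"
    and ex: "1 \<le> j0" "j0 \<le> p j0" "q j0 \<noteq> p j0 + 1"
  shows "\<exists>i j. 1 \<le> i \<and> 1 \<le> j \<and> j \<le> p i \<and>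
    (if i > j then p i + p j + 2 = i + j else i + j = q i + q j)"
proof -
  define S where "S = {j. 1 \<le> j \<and> j \<le> p j \<and> q j \<noteq> p j + 1}"
  have "S \<subseteq> {..q 1}"
  proof
    fix j assume "j \<in> S"
    then show "j \<in> {..q 1}" using conj[of j 1] by (simp add: S_def)
  qed
  then have fin: "finite S" by (rule finite_subset) simp
  have ne: "S \<noteq> {}" using ex by (auto simp: S_def)
  \<comment> \<open>Taking the last violation makes the relation hold at the next diagonal cell, if
    there is one; this is \<open>step\<close>.\<close>
  define j where "j = Max S"
  have "j \<in> S" unfolding j_def by (rule Max_in[OF fin ne])
  then have j: "1 \<le> j" "j \<le> p j" "q j \<noteq> p j + 1" by (auto simp: S_def)
  have jq: "j \<le> q j" using conj j by simp
  have "Suc j \<notin> S"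
    using Max_ge[OF fin, of "Suc j"] by (auto simp: j_def)
  then have step: "q (Suc j) = p (Suc j) + 1" if "Suc j \<le> p (Suc j)"
    using that by (auto simp: S_def)
  have diag: "Suc j \<le> p (Suc j) \<longleftrightarrow> Suc j \<le> q (Suc j)"
    using conj by simp
  have p_dec: "p (Suc j) \<le> p j"
    using conj[of "Suc j" "p (Suc j)"] conj[of j "p (Suc j)"] j(1) by (cases "p (Suc j)") auto
  have q_dec: "q (Suc j) \<le> q j"
    using conj[of "q (Suc j)" "Suc j"] conj[of "q (Suc j)" j] j(1) by (cases "q (Suc j)") auto
  show ?thesis
  proof (cases "q j > p j + 1")
    case True
    \<comment> \<open>Column \<open>j\<close> is long enough to reach row \<open>p j + 2\<close>. If
      that row went past column \<open>j\<close>, column \<open>j + 1\<close> would be too long for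
      \<open>step\<close> or for \<open>diag\<close>.\<close>
    define i where "i = p j + 2"
    have "j \<le> p i" using conj[of i j] True j by (simp add: i_def)
    moreover have "\<not> Suc j \<le> p i"
    proof
      assume "Suc j \<le> p i"
      then have "i \<le> q (Suc j)" using conj[of i "Suc j"] by (simp add: i_def)
      then show False using step diag p_dec j by (cases "Suc j \<le> p (Suc j)") (auto simp: i_def)
    qed
    ultimately have "p i = j" by simp
    then show ?thesis
      using j by (intro exI[of _ i] exI[of _ j]) (simp add: i_def)
  next
    case False
    \<comment> \<open>Here column \<open>j\<close> is too short. Column \<open>k\<close> turns out
      to have length \<open>j\<close>, so \<open>q j + q k = k + j\<close>.\<close>
    define k where "k = q j"
    have k: "k \<le> p j" "j \<le> k" using False j jq by (auto simp: k_def)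
    have "j \<le> q k" using conj[of j k] k j by simp
    moreover have "\<not> Suc j \<le> q k"
    proof
      assume "Suc j \<le> q k"
      then have le: "k \<le> p (Suc j)" using conj[of "Suc j" k] k j by simp
      show False
      proof (cases "Suc j \<le> p (Suc j)")
        case True
        then show False using step le q_dec by (simp add: k_def)
      next
        case False
        \<comment> \<open>Without a next diagonal cell, the inequalities force \<open>k = j\<close>;
          row \<open>j + 1\<close> then still meets column \<open>j\<close>, whose length is only
          \<open>j\<close>.\<close>
        then have "k = j" "p (Suc j) = j" using le k by auto
        then show False using conj[of "Suc j" j] j by (simp add: k_def)
      qed
    qed
    ultimately have "q k = j" by simp
    then show ?thesis
      using j k by (intro exI[of _ j] exI[of _ k]) (simp add: k_def)
  qed
qed

section \<open>Contents against hook lengths\<close>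

text \<open>
  In Frobenius coordinates the shape is \<open>(a\<^sub>1, a\<^sub>2, \<dots> | a\<^sub>1 + 1, a\<^sub>2 + 1, \<dots>)\<close> for
  \<open>e = 0\<close>, \<open>f = 1\<close>, and its conjugate for \<open>e = 1\<close>, \<open>f = 0\<close>.
\<close>

definition shifted :: "nat \<Rightarrow> nat \<Rightarrow> nat list \<Rightarrow> bool" where
  "shifted e f xs \<longleftrightarrow> (\<forall>i\<ge>1. i \<le> part xs i \<longrightarrow> conj_part xs i + e = part xs i + f)"

text \<open>
  A cell \<open>(i, j)\<close> has a diagonal index among its coordinates: \<open>j\<close> if \<open>i > j\<close>
  and \<open>i\<close> otherwise.
\<close>

lemma sp_content_shifted:
  assumes "sorted_wrt (\<ge>) xs" "shifted 0 1 xs" "u \<in> diagram xs"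
  shows "\<bar>sp_content xs u\<bar> = \<bar>hook_length xs u\<bar>"
proof -
  obtain i j where u: "u = (i, j)" by (cases u)
  have ij: "1 \<le> i" "1 \<le> j" "j \<le> part xs i" using assms(3) by (auto simp: u diagram_iff)
  show ?thesis
  proof (cases "i > j")
    case True
    then have "j \<le> part xs j" using ij part_antimono[OF assms(1), of j i] by simp
    then have "conj_part xs j = part xs j + 1" using assms(2) ij by (auto simp: shifted_def)
    then show ?thesis using True by (simp add: u)
  next
    case False
    then have "conj_part xs i = part xs i + 1" using assms(2) ij by (auto simp: shifted_def)
    then show ?thesis using False by (simp add: u)
  qed
qed

lemma orth_content_shifted:
  assumes "sorted_wrt (\<ge>) xs" "shifted 1 0 xs" "u \<in> diagram xs"
  shows "\<bar>orth_content xs u\<bar> = \<bar>hook_length xs u\<bar>"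
proof -
  obtain i j where u: "u = (i, j)" by (cases u)
  have ij: "1 \<le> i" "1 \<le> j" "j \<le> part xs i" using assms(3) by (auto simp: u diagram_iff)
  show ?thesis
  proof (cases "i \<ge> j")
    case True
    then have "j \<le> part xs j" using ij part_antimono[OF assms(1), of j i] by simp
    then have "conj_part xs j + 1 = part xs j" using assms(2) ij by (auto simp: shifted_def)
    then show ?thesis using True by (simp add: u)
  next
    case False
    then have "conj_part xs i + 1 = part xs i" using assms(2) ij by (auto simp: shifted_def)
    then show ?thesis using False by (simp add: u)
  qed
qed

lemma ex_sp_content_eq_0:
  assumes "sorted_wrt (\<ge>) xs" "\<not> shifted 0 1 xs"
  shows "\<exists>u\<in>diagram xs. sp_content xs u = 0"
proof -
  obtain k where "1 \<le> k" "k \<le> part xs k" "conj_part xs k \<noteq> part xs k + 1"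
    using assms(2) by (auto simp: shifted_def)
  from ex_zero_content_cell[of "part xs" "conj_part xs", OF le_part_iff_le_conj_part[OF assms(1)] this]
  obtain i j where "1 \<le> i" "1 \<le> j" "j \<le> part xs i"
    "if i > j then part xs i + part xs j + 2 = i + j else i + j = conj_part xs i + conj_part xs j"
    by blast
  then show ?thesis
    by (intro bexI[of _ "(i, j)"]) (auto simp: diagram_iff split: if_splits)
qed

text \<open>The orthogonal content of a cell is the negative of the symplectic content of the
  transposed cell in the conjugate shape. Hence rows and columns swap roles, and the witness is
  transposed.\<close>

lemma ex_orth_content_eq_0:
  assumes "sorted_wrt (\<ge>) xs" "\<not> shifted 1 0 xs"
  shows "\<exists>u\<in>diagram xs. orth_content xs u = 0"
proof -
  obtain k where k: "1 \<le> k" "k \<le> part xs k" "part xs k \<noteq> conj_part xs k + 1"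
    using assms(2) by (auto simp: shifted_def)
  have conj: "j \<le> conj_part xs i \<longleftrightarrow> i \<le> part xs j" if "1 \<le> i" "1 \<le> j" for i j
    using le_part_iff_le_conj_part[OF assms(1)] that by simp
  have "k \<le> conj_part xs k" using conj k by simp
  from ex_zero_content_cell[of "conj_part xs" "part xs", OF conj k(1) this k(3)]
  obtain i j where "1 \<le> i" "1 \<le> j" "j \<le> conj_part xs i"
    "if i > j then conj_part xs i + conj_part xs j + 2 = i + j else i + j = part xs i + part xs j"
    by blast
  then show ?thesis
    by (intro bexI[of _ "(j, i)"]) (auto simp: diagram_iff_conj[OF assms(1)] split: if_splits)
qed

text \<open>Squaring removes the signs. Positivity of the hook lengths ensures that equal squares
  have ratio 1, since \<open>0 / 0\<close> would be 0.\<close>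

lemma prod_content_hook_ratio:
  fixes c :: "nat list \<Rightarrow> nat \<times> nat \<Rightarrow> int"
  assumes "sorted_wrt (\<ge>) xs"
    and "P \<Longrightarrow> \<forall>u\<in>diagram xs. \<bar>c xs u\<bar> = \<bar>hook_length xs u\<bar>"
    and "\<not> P \<Longrightarrow> \<exists>u\<in>diagram xs. c xs u = 0"
  shows "(\<Prod>u\<in>diagram xs. (of_int (c xs u))\<^sup>2 / (of_int (hook_length xs u))\<^sup>2 :: rat)
    = (if P then 1 else 0)"
proof (cases P)
  case True
  have "(of_int (c xs u))\<^sup>2 / (of_int (hook_length xs u))\<^sup>2 = (1 :: rat)"
    if "u \<in> diagram xs" for u
  proof -
    have "(c xs u)\<^sup>2 = (hook_length xs u)\<^sup>2"
      using assms(2)[OF True] that by (metis power2_abs)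
    then have "(of_int (c xs u))\<^sup>2 = ((of_int (hook_length xs u))\<^sup>2 :: rat)"
      by (metis of_int_power)
    then show ?thesis using hook_length_pos[OF assms(1) that] by simp
  qed
  then have "(\<Prod>u\<in>diagram xs. (of_int (c xs u))\<^sup>2 / (of_int (hook_length xs u))\<^sup>2 :: rat) = 1"
    by (rule prod.neutral[OF ballI])
  then show ?thesis using True by (simp only: if_True)
next
  case False
  then show ?thesis
    using assms(3) by (auto simp: finite_diagram intro!: prod_zero)
qed

section \<open>Peeling off principal hooks\<close>

text \<open>
  The parts \<open>a\<close> are half the principal hook lengths: each hook has first row \<open>a + e\<close> and
  first column \<open>a + f\<close>, which share their corner. The subtraction does not truncate if
  \<open>e + f = 1\<close> and the list is strictly decreasing and positive.
\<close>

fun nest_hooks :: "nat \<Rightarrow> nat \<Rightarrow> nat list \<Rightarrow> nat list" where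
  "nest_hooks e f [] = []"
| "nest_hooks e f (a # as) =
    (let ys = nest_hooks e f as
     in (a + e) # map Suc ys @ replicate (a + f - 1 - length ys) 1)"

definition is_partition :: "nat list \<Rightarrow> bool" where
  "is_partition xs \<longleftrightarrow> sorted_wrt (\<ge>) xs \<and> 0 \<notin> set xs"

lemma is_partition_imp_sorted: "is_partition xs \<Longrightarrow> sorted_wrt (\<ge>) xs"
  by (simp add: is_partition_def)

lemma is_partition_hook_iff:
  "is_partition (m # map Suc ys @ replicate k 1) \<longleftrightarrow>
    is_partition ys \<and> 1 \<le> m \<and> (\<forall>y\<in>set ys. Suc y \<le> m)"
  if "0 \<notin> set ys"
proof -
  have "sorted_wrt (\<ge>) (replicate k (1::nat))" by (induction k) auto
  then show ?thesis
    using that by (auto simp: is_partition_def sorted_wrt_append sorted_wrt_map)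
qed

text \<open>The outer hook supplies the condition at index 1. Diagonal index \<open>i\<close> of
  \<open>ys\<close> becomes \<open>i + 1\<close> in \<open>xs\<close>, where row and column each
  gain one cell, so the difference is unchanged.\<close>

lemma shifted_hook_iff:
  assumes xs: "is_partition xs" "xs = m # map Suc ys @ replicate k 1" and ys: "is_partition ys"
  shows "shifted e f xs \<longleftrightarrow> 1 + length ys + k + e = m + f \<and> shifted e f ys"
proof -
  note conj_xs = le_part_iff_le_conj_part[OF is_partition_imp_sorted[OF xs(1)]]
  note conj_ys = le_part_iff_le_conj_part[OF is_partition_imp_sorted[OF ys]]
  have m: "1 \<le> m" using xs by (auto simp: is_partition_def)
  have p1: "part xs 1 = m" by (simp add: part_def xs(2))
  have pS: "part xs (Suc i) = (if i \<le> length ys then Suc (part ys i)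
      else if i \<le> length ys + k then 1 else 0)" if "1 \<le> i" for i
    using that by (cases i) (auto simp: part_def xs(2) nth_append)
  have diag: "Suc i \<le> part xs (Suc i) \<longleftrightarrow> i \<le> part ys i" if "1 \<le> i" for i
    using that pS[OF that] by (auto simp: part_def)
  have "i \<le> conj_part xs 1 \<longleftrightarrow> i \<le> length xs" if "1 \<le> i" for i
  proof -
    have "1 \<le> part xs i \<longleftrightarrow> i \<le> length xs"
    proof
      assume "i \<le> length xs"
      then have "part xs i \<in> set xs" using that by (simp add: part_def)
      moreover have "0 \<notin> set xs" using xs(1) by (simp add: is_partition_def)
      ultimately show "1 \<le> part xs i" by (metis less_one not_le)
    qed (use part_pos_imp_le_length[of 1 xs i] in simp)
    then show ?thesis using conj_xs[OF that, of 1] by simp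
  qed
  \<comment> \<open>Two naturals with the same positive lower bounds are equal; each is tested
    against the other.\<close>
  from this[of "conj_part xs 1"] this[of "length xs"]
  have q1: "conj_part xs 1 = 1 + length ys + k"
    using xs(2) by (cases "conj_part xs 1") auto
  have qS: "conj_part xs (Suc i) = Suc (conj_part ys i)" if i: "1 \<le> i" "i \<le> part ys i" for i
  proof -
    \<comment> \<open>The first row must reach column \<open>i + 1\<close> for that column to gain
      its extra cell.\<close>
    have im: "Suc i \<le> m"
      using part_antimono[OF is_partition_imp_sorted[OF xs(1)], of 1 "Suc i"] p1 diag[OF i(1)] i
      by linarith
    have "r \<le> conj_part xs (Suc i) \<longleftrightarrow> r \<le> Suc (conj_part ys i)" if "1 \<le> r" for r
    proof (cases "r = 1")
      case True
      then show ?thesis using conj_xs[of 1 "Suc i"] im p1 by simp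
    next
      case False
      then obtain s where s: "r = Suc s" "1 \<le> s" using \<open>1 \<le> r\<close> by (cases r) auto
      have "Suc i \<le> part xs (Suc s) \<longleftrightarrow> i \<le> part ys s"
        using pS[OF s(2)] i(1) by (auto simp: part_def)
      then show ?thesis using conj_xs[of r "Suc i"] conj_ys[of s i] s i by simp
    qed
    from this[of "conj_part xs (Suc i)"] this[of "Suc (conj_part ys i)"]
    show ?thesis by (cases "conj_part xs (Suc i)") auto
  qed
  have "shifted e f xs \<longleftrightarrow> conj_part xs 1 + e = part xs 1 + f \<and>
    (\<forall>i\<ge>1. Suc i \<le> part xs (Suc i) \<longrightarrow> conj_part xs (Suc i) + e = part xs (Suc i) + f)"
    (is "_ \<longleftrightarrow> ?R")
  proof
    assume R: ?R
    show "shifted e f xs"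
      unfolding shifted_def
    proof (intro allI impI)
      fix i :: nat assume i: "1 \<le> i" "i \<le> part xs i"
      show "conj_part xs i + e = part xs i + f"
      proof (cases "i = 1")
        case False
        then obtain s where "i = Suc s" "1 \<le> s" using i by (cases i) auto
        then show ?thesis using R i by simp
      qed (use R in simp)
    qed
  qed (use m p1 in \<open>auto simp: shifted_def\<close>)
  also have "\<dots> \<longleftrightarrow> 1 + length ys + k + e = m + f \<and> shifted e f ys"
  proof -
    have "conj_part xs (Suc i) + e = part xs (Suc i) + f \<longleftrightarrow> conj_part ys i + e = part ys i + f"
      if "1 \<le> i" "i \<le> part ys i" for i
      using qS[OF that] pS[OF that(1)] part_pos_imp_le_length[of i ys i] that by simp
    then show ?thesis using diag unfolding p1 q1 shifted_def by blast
  qed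
  finally show ?thesis .
qed

definition strict_partition :: "nat list \<Rightarrow> bool" where
  "strict_partition as \<longleftrightarrow> sorted_wrt (>) as \<and> 0 \<notin> set as"

lemma strict_partition_Cons:
  "strict_partition (a # as) \<longleftrightarrow> 1 \<le> a \<and> (\<forall>b\<in>set as. b < a) \<and> strict_partition as"
  by (auto simp: strict_partition_def)

text \<open>The bounds on length and parts carry the induction: with \<open>hd as < a\<close> they
  make the inner shape fit inside the next hook, which has
  \<open>(a + e) + (a + f) - 1 = 2 * a\<close> cells.\<close>

lemma nest_hooks_props:
  assumes ef: "e + f = 1" and "strict_partition as"
  shows "is_partition (nest_hooks e f as) \<and> shifted e f (nest_hooks e f as) \<and>
    sum_list (nest_hooks e f as) = 2 * sum_list as \<and>
    (as \<noteq> [] \<longrightarrow> length (nest_hooks e f as) = hd as + f) \<and>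
    (\<forall>y\<in>set (nest_hooks e f as). y \<le> hd as + e)"
  using assms(2)
proof (induction as)
  case Nil
  then show ?case by (simp add: is_partition_def shifted_def part_def)
next
  case (Cons a as)
  define ys where "ys = nest_hooks e f as"
  define k where "k = a + f - 1 - length ys"
  define xs where "xs = (a + e) # map Suc ys @ replicate k 1"
  have xs: "nest_hooks e f (a # as) = xs"
    by (simp add: xs_def ys_def k_def Let_def)
  have a: "1 \<le> a" "\<forall>b\<in>set as. b < a" "strict_partition as"
    using Cons.prems by (auto simp: strict_partition_Cons)
  have IH: "is_partition ys" "shifted e f ys" "sum_list ys = 2 * sum_list as"
    "as \<noteq> [] \<Longrightarrow> length ys = hd as + f" "\<forall>y\<in>set ys. y \<le> hd as + e"
    using Cons.IH[OF a(3)] by (auto simp: ys_def)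
  have hd: "as \<noteq> [] \<Longrightarrow> hd as < a" using a(2) by (cases as) auto
  have len: "length ys + k + 1 = a + f"
    using IH(4) hd a(1) by (cases "as = []") (auto simp: k_def ys_def)
  have small: "\<forall>y\<in>set ys. Suc y \<le> a + e"
    using IH(5) hd by (cases "as = []") (fastforce simp: ys_def)+
  have "is_partition xs"
    using is_partition_hook_iff[of ys "a + e" k] IH(1) a(1) small by (simp add: xs_def is_partition_def)
  moreover have "shifted e f xs"
    using shifted_hook_iff[OF \<open>is_partition xs\<close> xs_def IH(1)] IH(2) len by simp
  moreover have "sum_list (map Suc zs) = sum_list zs + length zs" for zs
    by (induction zs) auto
  then have "sum_list xs = 2 * sum_list (a # as)"
    using IH(3) len ef by (simp add: xs_def sum_list_replicate)
  ultimately show ?case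
    unfolding xs using len small a(1) by (auto simp: xs_def)
qed

text \<open>Successors of nonzero entries exceed 1, so discarding the ones recovers
  \<open>map Suc ys\<close>.\<close>

lemma map_Suc_append_ones_inject:
  assumes "map Suc ys @ replicate k 1 = map Suc zs @ replicate l 1" "0 \<notin> set ys" "0 \<notin> set zs"
  shows "ys = zs"
proof -
  have *: "filter (\<lambda>x. x > 1) (map Suc us @ replicate n 1) = map Suc us" if "0 \<notin> set us"
    for us :: "nat list" and n
    using that by (induction us) auto
  have "map Suc ys = map Suc zs"
    using *[OF assms(2), of k] *[OF assms(3), of l] unfolding assms(1) by (rule trans[OF sym])
  then show ?thesis by (simp only: inj_map_eq_map[OF inj_Suc])
qed

lemma nest_hooks_inject:
  assumes "e + f = 1" "strict_partition as" "strict_partition bs" "nest_hooks e f as = nest_hooks e f bs"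
  shows "as = bs"
  using assms(2-4)
proof (induction as arbitrary: bs)
  case Nil
  then show ?case by (cases bs) (auto simp: Let_def)
next
  case (Cons a as)
  then obtain b bs' where bs: "bs = b # bs'" by (cases bs) (auto simp: Let_def)
  have sp: "strict_partition as" "strict_partition bs'"
    using Cons.prems bs by (auto simp: strict_partition_Cons)
  have "0 \<notin> set (nest_hooks e f as)" "0 \<notin> set (nest_hooks e f bs')"
    using nest_hooks_props[OF assms(1)] sp by (auto simp: is_partition_def)
  then have "nest_hooks e f as = nest_hooks e f bs'"
    using Cons.prems(3) by (auto simp: bs Let_def intro: map_Suc_append_ones_inject)
  then show ?case using Cons.IH sp Cons.prems(3) by (auto simp: bs Let_def)
qed

text \<open>This deletes the first column: rows of length one disappear from \<open>ys\<close> and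
  are counted by \<open>k\<close>.\<close>

lemma partition_split_ones:
  assumes "is_partition xs"
  shows "\<exists>ys k. xs = map Suc ys @ replicate k 1 \<and> is_partition ys"
  using assms
proof (induction xs)
  case Nil
  then show ?case by (auto simp: is_partition_def)
next
  case (Cons x xs)
  then obtain ys k where *: "xs = map Suc ys @ replicate k 1" "is_partition ys"
    by (auto simp: is_partition_def)
  have x: "x \<ge> 1" "\<forall>y\<in>set xs. y \<le> x" using Cons.prems by (auto simp: is_partition_def Suc_le_eq)
  show ?case
  proof (cases "x = 1")
    case True
    have "ys = []"
      using x * True by (cases ys) (auto simp: is_partition_def)
    then show ?thesis using * True
      by (intro exI[of _ "[]"] exI[of _ "Suc k"]) (simp add: is_partition_def)
  next
    case False
    have "y \<le> x - 1" if "y \<in> set ys" for y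
    proof -
      have "Suc y \<in> set xs" using that by (simp add: *(1))
      then show ?thesis using x(2) by fastforce
    qed
    with False show ?thesis using x *
      by (intro exI[of _ "(x - 1) # ys"] exI[of _ k]) (auto simp: is_partition_def)
  qed
qed

text \<open>Removing the first row and column leaves a shorter list of the same type. The new half
  hook length is \<open>m - e\<close>. Structural induction would remove only the row.\<close>

lemma nest_hooks_surj:
  assumes "e + f = 1" "is_partition xs" "shifted e f xs"
  shows "\<exists>as. strict_partition as \<and> nest_hooks e f as = xs"
  using assms(2,3)
proof (induction xs rule: length_induct)
  case (1 xs)
  show ?case
  proof (cases xs)
    case Nil
    then show ?thesis by (intro exI[of _ "[]"]) (simp add: strict_partition_def)
  next
    case (Cons m zs)
    have "is_partition zs" using 1(2) Cons by (simp add: is_partition_def)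
    then obtain ys k where ys: "zs = map Suc ys @ replicate k 1" "is_partition ys"
      using partition_split_ones by blast
    note xs = Cons[unfolded ys(1)]
    have len: "1 + length ys + k + e = m + f" and sh: "shifted e f ys"
      using shifted_hook_iff[OF 1(2) xs ys(2)] 1(3) by auto
    have "length ys < length xs" by (simp add: xs)
    then obtain as where as: "strict_partition as" "nest_hooks e f as = ys"
      using 1(1) ys(2) sh by blast
    have m: "1 \<le> m" "\<forall>y\<in>set ys. Suc y \<le> m"
      using is_partition_hook_iff[of ys m k] ys(2) 1(2) xs by (auto simp: is_partition_def)
    have me: "e \<le> m" using assms(1) m(1) by simp
    have lys: "length ys = hd as + f" if "as \<noteq> []"
      using nest_hooks_props[OF assms(1) as(1)] as(2) that by simp
    \<comment> \<open>The first row of the inner shape has length \<open>hd as + e\<close> and stops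
      before the end of the outer row; this yields strictness.\<close>
    have hd_ys: "hd as + e < m" if "as \<noteq> []"
    proof -
      have "hd ys = hd as + e" "ys \<noteq> []"
        using that as(2) by (cases as; auto simp: Let_def)+
      then show ?thesis using m(2) by (metis hd_in_set Suc_le_eq)
    qed
    have le_hd: "b \<le> hd as" if "b \<in> set as" for b
      using as(1) that by (cases as) (auto simp: strict_partition_Cons)
    have "\<forall>b\<in>set as. b < m - e"
    proof
      fix b assume b: "b \<in> set as"
      then have "as \<noteq> []" by auto
      from hd_ys[OF this] le_hd[OF b] show "b < m - e" by simp
    qed
    \<comment> \<open>When \<open>e = 1\<close> and \<open>f = 0\<close>, the length equation
      \<open>len\<close> forces \<open>m\<close> to be at least 2.\<close>
    moreover have "1 \<le> m - e"
      using len hd_ys assms(1) m by linarith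
    ultimately have "strict_partition ((m - e) # as)"
      using as(1) by (simp add: strict_partition_Cons)
    moreover have "nest_hooks e f ((m - e) # as) = xs"
      using len me assms(1) as(2) by (simp add: Let_def xs)
    ultimately show ?thesis by blast
  qed
qed

lemma card_shifted_partitions:
  assumes "e + f = 1"
  shows "card {xs \<in> partitions_of n. shifted e f xs}
    = card {as. strict_partition as \<and> 2 * sum_list as = n}"
proof -
  have "bij_betw (nest_hooks e f) {as. strict_partition as \<and> 2 * sum_list as = n}
    {xs \<in> partitions_of n. shifted e f xs}"
    unfolding bij_betw_def
  proof
    show "inj_on (nest_hooks e f) {as. strict_partition as \<and> 2 * sum_list as = n}"
      using nest_hooks_inject[OF assms] by (auto simp: inj_on_def)
    show "nest_hooks e f ` {as. strict_partition as \<and> 2 * sum_list as = n}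
      = {xs \<in> partitions_of n. shifted e f xs}"
    proof (intro equalityI subsetI)
      fix xs assume "xs \<in> nest_hooks e f ` {as. strict_partition as \<and> 2 * sum_list as = n}"
      then show "xs \<in> {xs \<in> partitions_of n. shifted e f xs}"
        using nest_hooks_props[OF assms] by (auto simp: partitions_of_def is_partition_def)
    next
      fix xs assume xs: "xs \<in> {xs \<in> partitions_of n. shifted e f xs}"
      then obtain as where as: "strict_partition as" "nest_hooks e f as = xs"
        using nest_hooks_surj[OF assms] by (auto simp: partitions_of_def is_partition_def)
      with xs show "xs \<in> nest_hooks e f ` {as. strict_partition as \<and> 2 * sum_list as = n}"
        using nest_hooks_props[OF assms as(1)] by (auto simp: partitions_of_def)
    qed
  qed
  then show ?thesis by (simp add: bij_betw_same_card)
qed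

section \<open>Strict partitions and their generating function\<close>

text \<open>A strict partition is determined by its set of parts, and no part exceeds
  \<open>n\<close>. Such subsets index the terms of the expanded finite product below.\<close>

lemma card_strict_partitions:
  assumes "n \<le> N"
  shows "card {as. strict_partition as \<and> 2 * sum_list as = n} = card {S. S \<subseteq> {1..N} \<and> 2 * \<Sum>S = n}"
proof -
  have "bij_betw set {as. strict_partition as \<and> 2 * sum_list as = n} {S. S \<subseteq> {1..N} \<and> 2 * \<Sum>S = n}"
  proof (rule bij_betw_byWitness[where f' = "\<lambda>S. rev (sorted_list_of_set S)"])
    have dist: "distinct as" if "strict_partition as" for as
      using that strict_sorted_iff[of "rev as"] by (simp add: strict_partition_def sorted_wrt_rev)
    show "\<forall>as\<in>{as. strict_partition as \<and> 2 * sum_list as = n}. rev (sorted_list_of_set (set as)) = as"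
    proof
      fix as assume "as \<in> {as. strict_partition as \<and> 2 * sum_list as = n}"
      then have "sorted_wrt (<) (rev as)" by (simp add: strict_partition_def sorted_wrt_rev)
      then have "sorted_list_of_set (set (rev as)) = rev as"
        by (metis sorted_list_of_set.idem_if_sorted_distinct strict_sorted_iff)
      then show "rev (sorted_list_of_set (set as)) = as" by simp
    qed
    show "\<forall>S\<in>{S. S \<subseteq> {1..N} \<and> 2 * \<Sum>S = n}. set (rev (sorted_list_of_set S)) = S"
      by (auto dest: finite_subset)
    show "set ` {as. strict_partition as \<and> 2 * sum_list as = n} \<subseteq> {S. S \<subseteq> {1..N} \<and> 2 * \<Sum>S = n}"
    proof (rule image_subsetI)
      fix as assume "as \<in> {as. strict_partition as \<and> 2 * sum_list as = n}"
      then have as: "strict_partition as" "2 * sum_list as = n" by auto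
      have "\<Sum>(set as) = sum_list as" using dist[OF as(1)] by (simp add: distinct_sum_list_conv_Sum)
      moreover have "set as \<subseteq> {1..N}"
      proof
        fix a assume a: "a \<in> set as"
        then have "a \<noteq> 0" using as(1) by (metis strict_partition_def)
        then show "a \<in> {1..N}" using as(2) member_le_sum_list[OF a] assms by simp
      qed
      ultimately show "set as \<in> {S. S \<subseteq> {1..N} \<and> 2 * \<Sum>S = n}" using as(2) by simp
    qed
    show "(\<lambda>S. rev (sorted_list_of_set S)) ` {S. S \<subseteq> {1..N} \<and> 2 * \<Sum>S = n}
      \<subseteq> {as. strict_partition as \<and> 2 * sum_list as = n}"
    proof (rule image_subsetI)
      fix S :: "nat set" assume "S \<in> {S. S \<subseteq> {1..N} \<and> 2 * \<Sum>S = n}"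
      then have S: "S \<subseteq> {1..N}" "2 * \<Sum>S = n" by auto
      then have fin: "finite S" by (auto intro: finite_subset)
      have "sum_list (rev (sorted_list_of_set S)) = \<Sum>S"
        using fin by (simp add: sum_list_rev distinct_sum_list_conv_Sum)
      moreover have "strict_partition (rev (sorted_list_of_set S))"
        using S(1) fin by (auto simp: strict_partition_def sorted_wrt_rev)
      ultimately show "rev (sorted_list_of_set S) \<in> {as. strict_partition as \<and> 2 * sum_list as = n}"
        using S(2) by simp
    qed
  qed
  then show ?thesis by (rule bij_betw_same_card)
qed

lemma fps_nth_prod_one_plus_even_powers:
  "fps_nth (\<Prod>j\<in>{1..N}. 1 + fps_X ^ (2 * j) :: 'a::comm_ring_1 fps) n
    = of_nat (card {S. S \<subseteq> {1..N} \<and> 2 * \<Sum>S = n})"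
proof -
  have "(\<Prod>j\<in>{1..N}. 1 + fps_X ^ (2 * j) :: 'a fps) = (\<Prod>j\<in>{1..N}. fps_X ^ (2 * j) + 1)"
    by (simp add: add.commute)
  also have "\<dots> = (\<Sum>S\<in>Pow {1..N}. fps_X ^ (2 * \<Sum>S))"
    by (simp add: prod_add power_sum[symmetric] sum_distrib_left)
  finally have "fps_nth (\<Prod>j\<in>{1..N}. 1 + fps_X ^ (2 * j) :: 'a fps) n
      = (\<Sum>S\<in>Pow {1..N}. if n = 2 * \<Sum>S then 1 else 0)"
    by (simp add: fps_sum_nth fps_X_power_nth)
  also have "\<dots> = of_nat (card {S \<in> Pow {1..N}. n = 2 * \<Sum>S})"
    by (simp add: sum.If_cases Int_def)
  also have "{S \<in> Pow {1..N}. n = 2 * \<Sum>S} = {S. S \<subseteq> {1..N} \<and> 2 * \<Sum>S = n}" by auto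
  finally show ?thesis .
qed

section \<open>Euler's theorem on odd and distinct parts\<close>

text \<open>Odd and even exponents combine to \<open>1 - x ^ j\<close> for all \<open>j\<close> up
  to \<open>2 * N\<close>, and \<open>(1 + x ^ j) * (1 - x ^ j) = 1 - x ^ (2 * j)\<close>. The
  common factor stays on both sides because a commutative ring need not allow cancellation.\<close>

lemma euler_odd_distinct_finite:
  fixes x :: "'a::comm_ring_1"
  shows "(\<Prod>j\<in>{1..2 * N}. 1 + x ^ j) * (\<Prod>j<N. 1 - x ^ (2 * j + 1)) * (\<Prod>j\<in>{1..N}. 1 - x ^ (2 * j))
    = (\<Prod>j\<in>{1..N}. 1 - x ^ (2 * j)) * (\<Prod>j\<in>{N<..2 * N}. 1 - x ^ (2 * j))"
proof -
  have "(\<Prod>j<N. 1 - x ^ (2 * j + 1)) * (\<Prod>j\<in>{1..N}. 1 - x ^ (2 * j)) = (\<Prod>j\<in>{1..2 * N}. 1 - x ^ j)"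
    by (induction N) (simp_all add: mult_ac)
  then have "(\<Prod>j\<in>{1..2 * N}. 1 + x ^ j) * (\<Prod>j<N. 1 - x ^ (2 * j + 1)) * (\<Prod>j\<in>{1..N}. 1 - x ^ (2 * j))
    = (\<Prod>j\<in>{1..2 * N}. (1 + x ^ j) * (1 - x ^ j))"
    by (simp add: prod.distrib mult.assoc)
  also have "\<dots> = (\<Prod>j\<in>{1..2 * N}. 1 - x ^ (2 * j))"
    by (rule prod.cong) (simp_all add: algebra_simps flip: power_add mult_2_right)
  also have "\<dots> = (\<Prod>j\<in>{1..N} \<union> {N<..2 * N}. 1 - x ^ (2 * j))"
    by (rule prod.cong) auto
  also have "\<dots> = (\<Prod>j\<in>{1..N}. 1 - x ^ (2 * j)) * (\<Prod>j\<in>{N<..2 * N}. 1 - x ^ (2 * j))"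
    by (rule prod.union_disjoint) auto
  finally show ?thesis .
qed

text \<open>Modulo \<open>x ^ k\<close> every factor is 1. This controls the remainder of the
  truncated Euler identity.\<close>

lemma power_dvd_prod_minus_one:
  fixes x :: "'a::comm_ring_1"
  assumes "finite A" "\<And>a. a \<in> A \<Longrightarrow> k \<le> m a"
  shows "x ^ k dvd (\<Prod>a\<in>A. 1 - x ^ m a) - 1"
  using assms
proof (induction A)
  case (insert a A)
  have "(\<Prod>a\<in>insert a A. 1 - x ^ m a) - 1 = ((\<Prod>a\<in>A. 1 - x ^ m a) - 1) - x ^ m a * (\<Prod>a\<in>A. 1 - x ^ m a)"
    using insert by (simp add: algebra_simps)
  moreover have "x ^ k dvd x ^ m a" using insert.prems by (intro le_imp_power_dvd) simp
  ultimately show ?case using insert by (metis dvd_diff dvd_mult2 insert_iff)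
qed simp

lemma fps_nth_eq_if_X_power_dvd_diff:
  fixes f g :: "'a::comm_ring_1 fps"
  assumes "fps_X ^ k dvd f - g" "n < k"
  shows "fps_nth f n = fps_nth g n"
proof -
  obtain h where "f - g = fps_X ^ k * h" using assms(1) by (auto elim: dvdE)
  then have "fps_nth (f - g) n = 0" using assms(2) by (simp add: fps_X_power_mult_nth)
  then show ?thesis by simp
qed

text \<open>The finite identity at \<open>fps_X\<^sup>2\<close> gives \<open>A * Q = R\<close> after
  cancelling \<open>E\<close>. As \<open>P\<close> inverts \<open>Q\<close> and \<open>R\<close> is
  1 modulo \<open>fps_X ^ N\<close>, the series \<open>A\<close> and \<open>P\<close> agree below
  degree \<open>N\<close>.\<close>

lemma euler_coefficients:
  assumes "n < N"
  shows "fps_nth (\<Prod>j<N. 1 / (1 - fps_X ^ (4 * Suc j - 2)) :: rat fps) n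
    = of_nat (card {as. strict_partition as \<and> 2 * sum_list as = n})"
proof -
  define Q where "Q = (\<Prod>j<N. 1 - fps_X ^ (4 * j + 2) :: rat fps)"
  define A where "A = (\<Prod>j\<in>{1..2 * N}. 1 + fps_X ^ (2 * j) :: rat fps)"
  define R where "R = (\<Prod>j\<in>{N<..2 * N}. 1 - fps_X ^ (4 * j) :: rat fps)"
  define E where "E = (\<Prod>j\<in>{1..N}. 1 - fps_X ^ (4 * j) :: rat fps)"
  have "fps_nth (1 - fps_X ^ k :: rat fps) 0 = 1" if "k > 0" for k
    using that by (simp add: fps_X_power_nth)
  then have nz: "fps_nth (1 - fps_X ^ k :: rat fps) 0 \<noteq> 0" if "k > 0" for k
    using that by simp
  then have nz': "1 - fps_X ^ k \<noteq> (0 :: rat fps)" if "k > 0" for k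
    using that by (metis fps_zero_nth)
  have odd: "2 * (2 * j + 1) = 4 * j + 2" and even: "2 * (2 * j) = 4 * j" for j :: nat
    by simp_all
  have "A * Q * E = E * R"
    using euler_odd_distinct_finite[where N = N and x = "fps_X\<^sup>2 :: rat fps"]
    unfolding power_mult[symmetric] odd even A_def Q_def R_def E_def .
  moreover have "E \<noteq> 0" using nz' by (simp add: E_def)
  ultimately have AQ: "A * Q = R" by (simp add: mult.commute)
  define P where "P = (\<Prod>j<N. 1 / (1 - fps_X ^ (4 * Suc j - 2)) :: rat fps)"
  have "P * Q = (\<Prod>j<N. (1 / (1 - fps_X ^ (4 * j + 2))) * (1 - fps_X ^ (4 * j + 2)))"
    unfolding P_def Q_def prod.distrib by simp
  also have "\<dots> = 1"
    by (rule prod.neutral) (use nz in \<open>simp add: fps_divide_unit inverse_mult_eq_1\<close>)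
  finally have PQ: "P * Q = 1" .
  \<comment> \<open>Indeed \<open>A = A * Q * P = R * P\<close>.\<close>
  have "A - P = P * (R - 1)"
    using PQ AQ by (simp add: algebra_simps) (metis PQ mult.assoc mult.commute mult.left_neutral)
  moreover have "fps_X ^ N dvd R - 1"
    unfolding R_def by (rule power_dvd_prod_minus_one) auto
  ultimately have "fps_X ^ N dvd A - P" by simp
  then have "fps_nth A n = fps_nth P n"
    using assms by (rule fps_nth_eq_if_X_power_dvd_diff)
  then show ?thesis
    using fps_nth_prod_one_plus_even_powers[of "2 * N" n, where 'a = rat]
      card_strict_partitions[of n "2 * N"] assms
    by (simp add: A_def P_def)
qed

text \<open>Coefficient \<open>n\<close> of the partial products is constant from
  \<open>N = n\<close> on, which is convergence of formal power series.\<close>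

lemma euler_has_prod:
  "(\<lambda>j. 1 / (1 - fps_X ^ (4 * Suc j - 2)) :: rat fps) has_prod
    Abs_fps (\<lambda>n. of_nat (card {as. strict_partition as \<and> 2 * sum_list as = n}))"
    (is "?f has_prod ?F")
proof -
  have "(\<lambda>N. \<Prod>j\<le>N. ?f j) \<longlonglongrightarrow> ?F"
  proof (rule tendsto_fpsI)
    fix n
    have "fps_nth (\<Prod>j\<le>N. ?f j) n = fps_nth ?F n" if "n \<le> N" for N
      using euler_coefficients[of n "Suc N"] that unfolding lessThan_Suc_atMost by simp
    then show "\<forall>\<^sub>F N in sequentially. fps_nth (\<Prod>j\<le>N. ?f j) n = fps_nth ?F n"
      by (auto simp: eventually_at_top_linorder)
  qed
  \<comment> \<open>\<open>raw_has_prod\<close> demands a nonzero limit; the constant term provides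
    it.\<close>
  moreover have "fps_nth ?F 0 = 1"
    using euler_coefficients[of 0 1] by (simp add: fps_divide_unit fps_X_power_nth)
  then have "?F \<noteq> 0" by (metis fps_zero_nth zero_neq_one)
  ultimately show ?thesis by (simp add: has_prod_def raw_has_prod_def)
qed

section \<open>Summation over partitions\<close>

text \<open>The sum counts the surviving partitions. The count does not depend on which of
  \<open>e\<close> and \<open>f\<close> is 1, so the symplectic and orthogonal series
  coincide.\<close>

lemma sum_partitions_content_hook_ratio:
  fixes c :: "nat list \<Rightarrow> nat \<times> nat \<Rightarrow> int"
  assumes "e + f = 1"
    and "\<And>xs u. sorted_wrt (\<ge>) xs \<Longrightarrow> shifted e f xs \<Longrightarrow> u \<in> diagram xs \<Longrightarrow>
      \<bar>c xs u\<bar> = \<bar>hook_length xs u\<bar>"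
    and "\<And>xs. sorted_wrt (\<ge>) xs \<Longrightarrow> \<not> shifted e f xs \<Longrightarrow> \<exists>u\<in>diagram xs. c xs u = 0"
  shows "(\<Sum>xs\<in>partitions_of n. \<Prod>u\<in>diagram xs.
      (of_int (c xs u))\<^sup>2 / (of_int (hook_length xs u))\<^sup>2 :: rat)
    = of_nat (card {as. strict_partition as \<and> 2 * sum_list as = n})"
proof -
  have "(\<Sum>xs\<in>partitions_of n. \<Prod>u\<in>diagram xs.
      (of_int (c xs u))\<^sup>2 / (of_int (hook_length xs u))\<^sup>2 :: rat)
    = (\<Sum>xs\<in>partitions_of n. if shifted e f xs then 1 else 0)"
  proof (rule sum.cong)
    fix xs assume "xs \<in> partitions_of n"
    then have "sorted_wrt (\<ge>) xs" by (simp add: partitions_of_def)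
    then show "(\<Prod>u\<in>diagram xs. (of_int (c xs u))\<^sup>2 / (of_int (hook_length xs u))\<^sup>2 :: rat)
      = (if shifted e f xs then 1 else 0)"
      using assms(2,3) by (intro prod_content_hook_ratio) auto
  qed simp
  also have "\<dots> = of_nat (card {xs \<in> partitions_of n. shifted e f xs})"
    by (simp add: sum.If_cases finite_partitions_of Int_def)
  finally show ?thesis by (simp add: card_shifted_partitions[OF assms(1)])
qed

theorem theorem2p10:
  shows "convergent_prod (\<lambda>j. 1 / (1 - fps_X ^ (4 * Suc j - 2)) :: rat fps) \<and>
    Abs_fps (\<lambda>n. \<Sum>xs\<in>partitions_of n. \<Prod>u\<in>diagram xs.
        (of_int (sp_content xs u))\<^sup>2 / (of_int (hook_length xs u))\<^sup>2)
      = (\<Prod>j. 1 / (1 - fps_X ^ (4 * Suc j - 2)) :: rat fps) \<and>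
    (\<Prod>j. 1 / (1 - fps_X ^ (4 * Suc j - 2)) :: rat fps)
      = Abs_fps (\<lambda>n. \<Sum>xs\<in>partitions_of n. \<Prod>u\<in>diagram xs.
        (of_int (orth_content xs u))\<^sup>2 / (of_int (hook_length xs u))\<^sup>2)"
proof (intro conjI)
  note euler = has_prod_unique[OF euler_has_prod]
  show "convergent_prod (\<lambda>j. 1 / (1 - fps_X ^ (4 * Suc j - 2)) :: rat fps)"
    using euler_has_prod unfolding has_prod_def convergent_prod_def by blast
  from sum_partitions_content_hook_ratio[of 0 1, OF _ sp_content_shifted ex_sp_content_eq_0]
  show "Abs_fps (\<lambda>n. \<Sum>xs\<in>partitions_of n. \<Prod>u\<in>diagram xs.
      (of_int (sp_content xs u))\<^sup>2 / (of_int (hook_length xs u))\<^sup>2)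
    = (\<Prod>j. 1 / (1 - fps_X ^ (4 * Suc j - 2)) :: rat fps)"
    unfolding euler[symmetric] by simp
  from sum_partitions_content_hook_ratio[of 1 0, OF _ orth_content_shifted ex_orth_content_eq_0]
  show "(\<Prod>j. 1 / (1 - fps_X ^ (4 * Suc j - 2)) :: rat fps)
    = Abs_fps (\<lambda>n. \<Sum>xs\<in>partitions_of n. \<Prod>u\<in>diagram xs.
      (of_int (orth_content xs u))\<^sup>2 / (of_int (hook_length xs u))\<^sup>2)"
    unfolding euler[symmetric] by simp
qed

end
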